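(* Let $\mathscr{M}$ be a bicategory and let $\mathscr{K}$ be a class of maps (left adjoint 1-morphisms) of $\mathscr{M}$ which is closed under composition and includes the identities, regarded as a locally full sub-bicategory of $\mathscr{M}$. Let $j : A \to B$, $f : A \to X$, $r : B \to X$ be 1-morphisms of $\mathscr{K}$ and let $\rho : rj \Rightarrow f$ be a 2-morphism. Let $i_0 : B \to \mathrm{C}(j)$, $i_1 : A \to \mathrm{C}(j)$, $\nu : i_0 j \Rightarrow i_1$ be a collage of $j$ in $\mathscr{M}$, and let $\langle r, \rho\rangle : \mathrm{C}(j) \to X$ be the 1-morphism induced by $\rho$, with its canonical invertible 2-morphism $\langle r,\rho\rangle i_1 \cong f$. (i) If the invertible 2-morphism $\langle r,\rho\rangle i_1 \cong f$ exhibits $\langle r, \rho\rangle$ as a pointwise right extension of $f$ along $i_1$, then $\rho$ exhibits $r$ as a pointwise right extension of $f$ along $j$. (ii) If the collage is $\mathscr{K}$-compatible, then the converse also holds: if $\rho$ exhibits $r$ as a pointwise right extension of $f$ along $j$, then $\langle r,\rho\rangle i_1 \cong f$ exhibits $\langle r, \rho\rangle$ as a pointwise right extension of $f$ along $i_1$.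
   Context: A map in a bicategory is a 1-morphism $f$ having a right adjoint $f^*$. "Locally full" means that all 2-morphisms of $\mathscr{M}$ between 1-morphisms of $\mathscr{K}$ are in $\mathscr{K}$. Right extension: a 2-morphism $\rho : rj \Rightarrow f$ (with $j : A\to B$, $f : A\to X$, $r : B \to X$) exhibits $r$ as a right extension of $f$ along $j$ in a bicategory when, for every 1-morphism $g : B \to X$, the assignment $\theta \mapsto \rho\cdot(\theta j)$ is a bijection between 2-morphisms $\theta : g \Rightarrow r$ and 2-morphisms $gj \Rightarrow f$. Pointwise right extension: a 2-morphism $\rho : rj \Rightarrow f$ exhibits $r$ as a pointwise right extension of $f$ along $j$ (in $\mathscr{K}$) when $j,f,r$ are all in $\mathscr{K}$ and $\rho$ exhibits $r$ as a right extension of $f$ along $j$ in $\mathscr{M}$. Collage: a collage (lax colimit) of $j : A \to B$ in $\mathscr{M}$ is an object $\mathrm{C}(j)$ with 1-morphisms $i_0 : B \to \mathrm{C}(j)$, $i_1 : A \to \mathrm{C}(j)$ and a 2-morphism $\nu : i_0 j \Rightarrow i_1$ such that, for every object $X$, the functor $h \mapsto (hi_0,\ h\nu,\ hi_1)$ is an equivalence of categories $\mathscr{M}(\mathrm{C}(j),X) \simeq \mathscr{M}(j,X)/\mathscr{M}(A,X)$, where the right-hand side is the comma category of the functor $\mathscr{M}(j,X) : \mathscr{M}(B,X) \to \mathscr{M}(A,X)$ (precomposition with $j$) and the identity functor of $\mathscr{M}(A,X)$; its objects are triples $(r, \rho : rj \Rightarrow f, f)$. Induced 1-morphism: $\rho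 : rj\Rightarrow f$ induces, by this universal property, a 1-morphism $\langle r,\rho\rangle : \mathrm{C}(j) \to X$ together with invertible 2-morphisms $f \cong \langle r,\rho\rangle i_1$ and $r \cong \langle r,\rho\rangle i_0$ which conjugate $\langle r,\rho\rangle\nu$ to give $\rho$. $\mathscr{K}$-compatible: the collage is $\mathscr{K}$-compatible when (1) $i_0$ and $i_1$ are in $\mathscr{K}$; (2) for any $h : \mathrm{C}(j) \to X$ in $\mathscr{M}$, if $hi_0$ and $hi_1$ are in $\mathscr{K}$, so is $h$; and (3) the mate $\hat{\nu} : j i_1^* \Rightarrow i_0^*$ of $\nu$ under the adjunctions $i_0 \dashv i_0^*$, $i_1\dashv i_1^*$ exhibits $\mathrm{C}(j)$ as a lax limit of $j$ in $\mathscr{M}$, i.e. for every object $Y$ the functor $k \mapsto (i_1^*k,\ \hat{\nu}k,\ i_0^*k)$ is an equivalence from $\mathscr{M}(Y,\mathrm{C}(j))$ to the category of triples $(a : Y \to A,\ ja \Rightarrow b,\ b : Y\to B)$ (the comma category of $\mathscr{M}(Y,j)$ and the identity functor of $\mathscr{M}(Y,B)$).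
   Formalization: In part (ii) the class K is additionally assumed closed under invertible 2-morphisms (a 1-morphism isomorphic to one in K is in K); without this, ⟨r,ρ⟩, determined only up to isomorphism, need not lie in K and (ii) can fail. *)

theory Defs
  imports Main
begin

section \<open>Categories, functors, equivalences, comma categories\<close>

record ('o, 'a) cat =
  Obj :: "'o set"
  Arr :: "'a set"
  Dom :: "'a \<Rightarrow> 'o"
  Cod :: "'a \<Rightarrow> 'o"
  Ident :: "'o \<Rightarrow> 'a"
  Comp :: "'a \<Rightarrow> 'a \<Rightarrow> 'a"  \<comment> \<open>\<open>Comp C g f\<close> is \<open>g\<close> after \<open>f\<close>\<close>

definition arrows :: "('o, 'a) cat \<Rightarrow> 'o \<Rightarrow> 'o \<Rightarrow> 'a set" where
  "arrows C x y = {f \<in> Arr C. Dom C f = x \<and> Cod C f = y}"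

locale category =
  fixes C :: "('o, 'a) cat"
  assumes Dom_Obj: "f \<in> Arr C \<Longrightarrow> Dom C f \<in> Obj C"
    and Cod_Obj: "f \<in> Arr C \<Longrightarrow> Cod C f \<in> Obj C"
    and Ident_arrow: "x \<in> Obj C \<Longrightarrow> Ident C x \<in> arrows C x x"
    and Comp_arrow: "f \<in> arrows C x y \<Longrightarrow> g \<in> arrows C y z \<Longrightarrow> Comp C g f \<in> arrows C x z"
    and Ident_left: "f \<in> arrows C x y \<Longrightarrow> Comp C (Ident C y) f = f"
    and Ident_right: "f \<in> arrows C x y \<Longrightarrow> Comp C f (Ident C x) = f"
    and Comp_assoc: "f \<in> arrows C w x \<Longrightarrow> g \<in> arrows C x y \<Longrightarrow> h \<in> arrows C y z \<Longrightarrow>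
      Comp C (Comp C h g) f = Comp C h (Comp C g f)"

definition iso_arrow :: "('o, 'a) cat \<Rightarrow> 'a \<Rightarrow> bool" where
  "iso_arrow C f \<longleftrightarrow> f \<in> Arr C \<and>
    (\<exists>g \<in> arrows C (Cod C f) (Dom C f).
      Comp C g f = Ident C (Dom C f) \<and> Comp C f g = Ident C (Cod C f))"

record ('o, 'a, 'p, 'b) func =
  fobj :: "'o \<Rightarrow> 'p"
  farr :: "'a \<Rightarrow> 'b"

definition id_func :: "('o, 'a, 'o, 'a) func" where
  "id_func = \<lparr>fobj = (\<lambda>x. x), farr = (\<lambda>u. u)\<rparr>"

definition comp_func ::
  "('p, 'b, 'q, 'c) func \<Rightarrow> ('o, 'a, 'p, 'b) func \<Rightarrow> ('o, 'a, 'q, 'c) func" where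
  "comp_func G F = \<lparr>fobj = (\<lambda>x. fobj G (fobj F x)), farr = (\<lambda>u. farr G (farr F u))\<rparr>"

definition is_functor :: "('o, 'a) cat \<Rightarrow> ('p, 'b) cat \<Rightarrow> ('o, 'a, 'p, 'b) func \<Rightarrow> bool" where
  "is_functor C D F \<longleftrightarrow> category C \<and> category D \<and>
    (\<forall>x \<in> Obj C. fobj F x \<in> Obj D) \<and>
    (\<forall>x y. \<forall>u \<in> arrows C x y. farr F u \<in> arrows D (fobj F x) (fobj F y)) \<and>
    (\<forall>x \<in> Obj C. farr F (Ident C x) = Ident D (fobj F x)) \<and>
    (\<forall>x y z. \<forall>u \<in> arrows C x y. \<forall>v \<in> arrows C y z.
      farr F (Comp C v u) = Comp D (farr F v) (farr F u))"

definition natural_iso ::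
  "('o, 'a) cat \<Rightarrow> ('p, 'b) cat \<Rightarrow> ('o, 'a, 'p, 'b) func \<Rightarrow> ('o, 'a, 'p, 'b) func \<Rightarrow>
    ('o \<Rightarrow> 'b) \<Rightarrow> bool" where
  "natural_iso C D F G \<tau> \<longleftrightarrow> is_functor C D F \<and> is_functor C D G \<and>
    (\<forall>x \<in> Obj C. \<tau> x \<in> arrows D (fobj F x) (fobj G x) \<and> iso_arrow D (\<tau> x)) \<and>
    (\<forall>x y. \<forall>u \<in> arrows C x y. Comp D (\<tau> y) (farr F u) = Comp D (farr G u) (\<tau> x))"

definition is_equivalence ::
  "('o, 'a) cat \<Rightarrow> ('p, 'b) cat \<Rightarrow> ('o, 'a, 'p, 'b) func \<Rightarrow> bool" where
  "is_equivalence C D F \<longleftrightarrow> is_functor C D F \<and>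
    (\<exists>G \<eta> \<epsilon>. is_functor D C G \<and>
      natural_iso C C id_func (comp_func G F) \<eta> \<and>
      natural_iso D D (comp_func F G) id_func \<epsilon>)"

text \<open>
  The comma category of \<open>F : C \<rightarrow> E\<close> and \<open>G : D \<rightarrow> E\<close>. Its objects are triples
  \<open>(c, e : F c \<rightarrow> G d, d)\<close>. An arrow is a pair \<open>(u, v)\<close> stored together with its domain and
  codomain, since the same pair can be an arrow between several pairs of objects.
\<close>

definition comma ::
  "('o, 'a) cat \<Rightarrow> ('p, 'b) cat \<Rightarrow> ('q, 'c) cat \<Rightarrow> ('o, 'a, 'q, 'c) func \<Rightarrow> ('p, 'b, 'q, 'c) func \<Rightarrow>
    ('o \<times> 'c \<times> 'p, ('o \<times> 'c \<times> 'p) \<times> ('a \<times> 'b) \<times> ('o \<times> 'c \<times> 'p)) cat" where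
  "comma C D E F G =
    (let objs = {(c, e, d). c \<in> Obj C \<and> d \<in> Obj D \<and> e \<in> arrows E (fobj F c) (fobj G d)}
     in \<lparr>Obj = objs,
         Arr = {((c, e, d), (u, v), (c', e', d')).
                 (c, e, d) \<in> objs \<and> (c', e', d') \<in> objs \<and>
                 u \<in> arrows C c c' \<and> v \<in> arrows D d d' \<and>
                 Comp E e' (farr F u) = Comp E (farr G v) e},
         Dom = (\<lambda>(x, w, y). x),
         Cod = (\<lambda>(x, w, y). y),
         Ident = (\<lambda>(c, e, d). ((c, e, d), (Ident C c, Ident D d), (c, e, d))),
         Comp = (\<lambda>(x', (u', v'), y') (x, (u, v), y). (x, (Comp C u' u, Comp D v' v), y'))\<rparr>)"


section \<open>Bicategories\<close>

record ('o, 'm, 't) bicat =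
  Ob :: "'o set"
  Mor :: "'m set"
  src :: "'m \<Rightarrow> 'o"
  trg :: "'m \<Rightarrow> 'o"
  Cell :: "'t set"
  dom2 :: "'t \<Rightarrow> 'm"
  cod2 :: "'t \<Rightarrow> 'm"
  id1 :: "'o \<Rightarrow> 'm"
  comp1 :: "'m \<Rightarrow> 'm \<Rightarrow> 'm" (infixr "\<odot>\<index>" 75)
  id2 :: "'m \<Rightarrow> 't"
  vcomp :: "'t \<Rightarrow> 't \<Rightarrow> 't" (infixr "\<cdot>\<index>" 65)
  hcomp :: "'t \<Rightarrow> 't \<Rightarrow> 't" (infixr "\<star>\<index>" 75)
  assoc :: "'m \<Rightarrow> 'm \<Rightarrow> 'm \<Rightarrow> 't"
  lunit :: "'m \<Rightarrow> 't"
  runit :: "'m \<Rightarrow> 't"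

text \<open>
  All compositions are written in applicative order, so \<open>g \<odot> f\<close> is \<open>g\<close> after \<open>f\<close>.
  The coherence cells are oriented as \<open>assoc h g f : (h \<odot> g) \<odot> f \<Rightarrow> h \<odot> (g \<odot> f)\<close>,
  \<open>lunit f : id1 (trg f) \<odot> f \<Rightarrow> f\<close> and \<open>runit f : f \<odot> id1 (src f) \<Rightarrow> f\<close>.
\<close>

definition hom1 :: "('o, 'm, 't) bicat \<Rightarrow> 'o \<Rightarrow> 'o \<Rightarrow> 'm set" where
  "hom1 M A B = {f \<in> Mor M. src M f = A \<and> trg M f = B}"

definition hom2 :: "('o, 'm, 't) bicat \<Rightarrow> 'm \<Rightarrow> 'm \<Rightarrow> 't set" where
  "hom2 M f g = {\<alpha> \<in> Cell M. dom2 M \<alpha> = f \<and> cod2 M \<alpha> = g}"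

definition hom_cat :: "('o, 'm, 't) bicat \<Rightarrow> 'o \<Rightarrow> 'o \<Rightarrow> ('m, 't) cat" where
  "hom_cat M A B =
    \<lparr>Obj = hom1 M A B,
     Arr = {\<alpha> \<in> Cell M. dom2 M \<alpha> \<in> hom1 M A B \<and> cod2 M \<alpha> \<in> hom1 M A B},
     Dom = dom2 M, Cod = cod2 M, Ident = id2 M, Comp = vcomp M\<rparr>"

definition inverse2 :: "('o, 'm, 't) bicat \<Rightarrow> 't \<Rightarrow> 't \<Rightarrow> bool" where
  "inverse2 M \<alpha> \<beta> \<longleftrightarrow> \<alpha> \<in> Cell M \<and> \<beta> \<in> hom2 M (cod2 M \<alpha>) (dom2 M \<alpha>) \<and>
    \<beta> \<cdot>\<^bsub>M\<^esub> \<alpha> = id2 M (dom2 M \<alpha>) \<and> \<alpha> \<cdot>\<^bsub>M\<^esub> \<beta> = id2 M (cod2 M \<alpha>)"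

definition invertible2 :: "('o, 'm, 't) bicat \<Rightarrow> 't \<Rightarrow> bool" where
  "invertible2 M \<alpha> \<longleftrightarrow> (\<exists>\<beta>. inverse2 M \<alpha> \<beta>)"

definition inv2 :: "('o, 'm, 't) bicat \<Rightarrow> 't \<Rightarrow> 't" where
  "inv2 M \<alpha> = (THE \<beta>. inverse2 M \<alpha> \<beta>)"

locale bicategory =
  fixes M :: "('o, 'm, 't) bicat" (structure)
  assumes src_Ob: "f \<in> Mor M \<Longrightarrow> src M f \<in> Ob M"
    and trg_Ob: "f \<in> Mor M \<Longrightarrow> trg M f \<in> Ob M"
    and dom2_Mor: "\<alpha> \<in> Cell M \<Longrightarrow> dom2 M \<alpha> \<in> Mor M"
    and cod2_Mor: "\<alpha> \<in> Cell M \<Longrightarrow> cod2 M \<alpha> \<in> Mor M"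
    and src_parallel: "\<alpha> \<in> Cell M \<Longrightarrow> src M (dom2 M \<alpha>) = src M (cod2 M \<alpha>)"
    and trg_parallel: "\<alpha> \<in> Cell M \<Longrightarrow> trg M (dom2 M \<alpha>) = trg M (cod2 M \<alpha>)"
    and category_hom: "A \<in> Ob M \<Longrightarrow> B \<in> Ob M \<Longrightarrow> category (hom_cat M A B)"
    and id1_hom: "A \<in> Ob M \<Longrightarrow> id1 M A \<in> hom1 M A A"
    and comp1_hom: "f \<in> hom1 M A B \<Longrightarrow> g \<in> hom1 M B C \<Longrightarrow> g \<odot> f \<in> hom1 M A C"
    and hcomp_hom: "f \<in> hom1 M A B \<Longrightarrow> g \<in> hom1 M B C \<Longrightarrow>
      \<alpha> \<in> hom2 M f f' \<Longrightarrow> \<beta> \<in> hom2 M g g' \<Longrightarrow> \<beta> \<star> \<alpha> \<in> hom2 M (g \<odot> f) (g' \<odot> f')"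
    and hcomp_id2: "f \<in> hom1 M A B \<Longrightarrow> g \<in> hom1 M B C \<Longrightarrow>
      id2 M g \<star> id2 M f = id2 M (g \<odot> f)"
    and interchange: "f \<in> hom1 M A B \<Longrightarrow> g \<in> hom1 M B C \<Longrightarrow>
      \<alpha> \<in> hom2 M f f' \<Longrightarrow> \<alpha>' \<in> hom2 M f' f'' \<Longrightarrow>
      \<beta> \<in> hom2 M g g' \<Longrightarrow> \<beta>' \<in> hom2 M g' g'' \<Longrightarrow>
      (\<beta>' \<cdot> \<beta>) \<star> (\<alpha>' \<cdot> \<alpha>) = (\<beta>' \<star> \<alpha>') \<cdot> (\<beta> \<star> \<alpha>)"
    and assoc_hom: "f \<in> hom1 M A B \<Longrightarrow> g \<in> hom1 M B C \<Longrightarrow> h \<in> hom1 M C D \<Longrightarrow>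
      assoc M h g f \<in> hom2 M ((h \<odot> g) \<odot> f) (h \<odot> (g \<odot> f))"
    and assoc_invertible: "f \<in> hom1 M A B \<Longrightarrow> g \<in> hom1 M B C \<Longrightarrow> h \<in> hom1 M C D \<Longrightarrow>
      invertible2 M (assoc M h g f)"
    and assoc_natural: "f \<in> hom1 M A B \<Longrightarrow> g \<in> hom1 M B C \<Longrightarrow> h \<in> hom1 M C D \<Longrightarrow>
      \<alpha> \<in> hom2 M f f' \<Longrightarrow> \<beta> \<in> hom2 M g g' \<Longrightarrow> \<gamma> \<in> hom2 M h h' \<Longrightarrow>
      assoc M h' g' f' \<cdot> ((\<gamma> \<star> \<beta>) \<star> \<alpha>) = (\<gamma> \<star> (\<beta> \<star> \<alpha>)) \<cdot> assoc M h g f"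
    and lunit_hom: "f \<in> hom1 M A B \<Longrightarrow> lunit M f \<in> hom2 M (id1 M B \<odot> f) f"
    and lunit_invertible: "f \<in> hom1 M A B \<Longrightarrow> invertible2 M (lunit M f)"
    and lunit_natural: "f \<in> hom1 M A B \<Longrightarrow> \<alpha> \<in> hom2 M f f' \<Longrightarrow>
      lunit M f' \<cdot> (id2 M (id1 M B) \<star> \<alpha>) = \<alpha> \<cdot> lunit M f"
    and runit_hom: "f \<in> hom1 M A B \<Longrightarrow> runit M f \<in> hom2 M (f \<odot> id1 M A) f"
    and runit_invertible: "f \<in> hom1 M A B \<Longrightarrow> invertible2 M (runit M f)"
    and runit_natural: "f \<in> hom1 M A B \<Longrightarrow> \<alpha> \<in> hom2 M f f' \<Longrightarrow>
      runit M f' \<cdot> (\<alpha> \<star> id2 M (id1 M A)) = \<alpha> \<cdot> runit M f"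
    and pentagon: "f \<in> hom1 M A B \<Longrightarrow> g \<in> hom1 M B C \<Longrightarrow> h \<in> hom1 M C D \<Longrightarrow> k \<in> hom1 M D E \<Longrightarrow>
      (id2 M k \<star> assoc M h g f) \<cdot> assoc M k (h \<odot> g) f \<cdot> (assoc M k h g \<star> id2 M f) =
      assoc M k h (g \<odot> f) \<cdot> assoc M (k \<odot> h) g f"
    and triangle: "f \<in> hom1 M A B \<Longrightarrow> g \<in> hom1 M B C \<Longrightarrow>
      (id2 M g \<star> lunit M f) \<cdot> assoc M g (id1 M B) f = runit M g \<star> id2 M f"
begin

text \<open>The hom-functors \<open>M(j, X) : M(B, X) \<rightarrow> M(A, X)\<close> and \<open>M(Y, j) : M(Y, A) \<rightarrow> M(Y, B)\<close>:\<close>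

definition precomp :: "'m \<Rightarrow> ('m, 't, 'm, 't) func" where
  "precomp j = \<lparr>fobj = (\<lambda>g. g \<odot> j), farr = (\<lambda>\<theta>. \<theta> \<star> id2 M j)\<rparr>"

definition postcomp :: "'m \<Rightarrow> ('m, 't, 'm, 't) func" where
  "postcomp j = \<lparr>fobj = (\<lambda>g. j \<odot> g), farr = (\<lambda>\<theta>. id2 M j \<star> \<theta>)\<rparr>"


subsection \<open>Maps\<close>

definition adjunction :: "'m \<Rightarrow> 'm \<Rightarrow> 't \<Rightarrow> 't \<Rightarrow> bool" where
  "adjunction f u \<eta> \<epsilon> \<longleftrightarrow>
    f \<in> Mor M \<and> u \<in> hom1 M (trg M f) (src M f) \<and>
    \<eta> \<in> hom2 M (id1 M (src M f)) (u \<odot> f) \<and>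
    \<epsilon> \<in> hom2 M (f \<odot> u) (id1 M (trg M f)) \<and>
    lunit M f \<cdot> (\<epsilon> \<star> id2 M f) \<cdot> inv2 M (assoc M f u f) \<cdot> (id2 M f \<star> \<eta>) \<cdot> inv2 M (runit M f)
      = id2 M f \<and>
    runit M u \<cdot> (id2 M u \<star> \<epsilon>) \<cdot> assoc M u f u \<cdot> (\<eta> \<star> id2 M u) \<cdot> inv2 M (lunit M u)
      = id2 M u"

definition is_map :: "'m \<Rightarrow> bool" where
  "is_map f \<longleftrightarrow> (\<exists>u \<eta> \<epsilon>. adjunction f u \<eta> \<epsilon>)"

text \<open>
  A class of maps closed under composition and containing the identities. As a sub-bicategory
  it is locally full, so it is determined by its 1-morphisms.
\<close>

definition map_class :: "'m set \<Rightarrow> bool" where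
  "map_class K \<longleftrightarrow>
    (\<forall>f \<in> K. is_map f) \<and>
    (\<forall>A \<in> Ob M. id1 M A \<in> K) \<and>
    (\<forall>f \<in> K. \<forall>g \<in> K. src M g = trg M f \<longrightarrow> g \<odot> f \<in> K)"

text \<open>
  Closure under invertible 2-morphisms. It matters where a 1-morphism is determined only up to
  isomorphism: \<open>r \<cong> h \<odot> i\<^sub>0\<close> with \<open>r\<close> in \<open>K\<close> does not by itself put \<open>h \<odot> i\<^sub>0\<close> in \<open>K\<close>.
\<close>

definition iso_closed :: "'m set \<Rightarrow> bool" where
  "iso_closed K \<longleftrightarrow> (\<forall>f \<in> K. \<forall>g. \<forall>\<phi> \<in> hom2 M f g. invertible2 M \<phi> \<longrightarrow> g \<in> K)"


subsection \<open>Right extensions\<close>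

definition right_extension :: "'m \<Rightarrow> 'm \<Rightarrow> 'm \<Rightarrow> 't \<Rightarrow> bool" where
  "right_extension j f r \<rho> \<longleftrightarrow>
    j \<in> Mor M \<and> f \<in> hom1 M (src M j) (trg M f) \<and> r \<in> hom1 M (trg M j) (trg M f) \<and>
    \<rho> \<in> hom2 M (r \<odot> j) f \<and>
    (\<forall>g \<in> hom1 M (trg M j) (trg M f).
      bij_betw (\<lambda>\<theta>. \<rho> \<cdot> (\<theta> \<star> id2 M j)) (hom2 M g r) (hom2 M (g \<odot> j) f))"

definition pointwise_right_extension :: "'m set \<Rightarrow> 'm \<Rightarrow> 'm \<Rightarrow> 'm \<Rightarrow> 't \<Rightarrow> bool" where
  "pointwise_right_extension K j f r \<rho> \<longleftrightarrow>
    j \<in> K \<and> f \<in> K \<and> r \<in> K \<and> right_extension j f r \<rho>"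


subsection \<open>Collages\<close>

text \<open>
  The category \<open>M(j, X) / M(A, X)\<close> of triples \<open>(r, \<rho> : r \<odot> j \<Rightarrow> f, f)\<close>, where \<open>j : A \<rightarrow> B\<close>:
\<close>

definition cocone_cat ::
  "'m \<Rightarrow> 'o \<Rightarrow> ('m \<times> 't \<times> 'm, ('m \<times> 't \<times> 'm) \<times> ('t \<times> 't) \<times> ('m \<times> 't \<times> 'm)) cat" where
  "cocone_cat j X =
    comma (hom_cat M (trg M j) X) (hom_cat M (src M j) X) (hom_cat M (src M j) X)
      (precomp j) id_func"

text \<open>The whiskering \<open>h \<nu>\<close> regarded as a 2-morphism \<open>(h \<odot> i\<^sub>0) \<odot> j \<Rightarrow> h \<odot> i\<^sub>1\<close>:\<close>

definition whisker_nu :: "'m \<Rightarrow> 'm \<Rightarrow> 't \<Rightarrow> 'm \<Rightarrow> 't" where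
  "whisker_nu j i\<^sub>0 \<nu> h = (id2 M h \<star> \<nu>) \<cdot> assoc M h i\<^sub>0 j"

definition collage_func ::
  "'m \<Rightarrow> 'm \<Rightarrow> 'm \<Rightarrow> 't \<Rightarrow>
    ('m, 't, 'm \<times> 't \<times> 'm, ('m \<times> 't \<times> 'm) \<times> ('t \<times> 't) \<times> ('m \<times> 't \<times> 'm)) func" where
  "collage_func j i\<^sub>0 i\<^sub>1 \<nu> =
    (let F = (\<lambda>h. (h \<odot> i\<^sub>0, whisker_nu j i\<^sub>0 \<nu> h, h \<odot> i\<^sub>1))
     in \<lparr>fobj = F,
         farr = (\<lambda>\<theta>. (F (dom2 M \<theta>), (\<theta> \<star> id2 M i\<^sub>0, \<theta> \<star> id2 M i\<^sub>1), F (cod2 M \<theta>)))\<rparr>)"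

definition collage :: "'m \<Rightarrow> 'o \<Rightarrow> 'm \<Rightarrow> 'm \<Rightarrow> 't \<Rightarrow> bool" where
  "collage j Cj i\<^sub>0 i\<^sub>1 \<nu> \<longleftrightarrow>
    j \<in> Mor M \<and> Cj \<in> Ob M \<and> i\<^sub>0 \<in> hom1 M (trg M j) Cj \<and> i\<^sub>1 \<in> hom1 M (src M j) Cj \<and>
    \<nu> \<in> hom2 M (i\<^sub>0 \<odot> j) i\<^sub>1 \<and>
    (\<forall>X \<in> Ob M. is_equivalence (hom_cat M Cj X) (cocone_cat j X) (collage_func j i\<^sub>0 i\<^sub>1 \<nu>))"

text \<open>
  \<open>h\<close>, with \<open>\<sigma>\<^sub>0 : r \<cong> h \<odot> i\<^sub>0\<close> and \<open>\<sigma>\<^sub>1 : h \<odot> i\<^sub>1 \<cong> f\<close>, is a 1-morphism \<open>\<langle>r, \<rho>\<rangle>\<close> induced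
  by \<open>\<rho> : r \<odot> j \<Rightarrow> f\<close>. It is determined only up to isomorphism by these data.
\<close>

definition induced ::
  "'m \<Rightarrow> 'o \<Rightarrow> 'm \<Rightarrow> 'm \<Rightarrow> 't \<Rightarrow> 'm \<Rightarrow> 'm \<Rightarrow> 't \<Rightarrow> 'm \<Rightarrow> 't \<Rightarrow> 't \<Rightarrow> bool" where
  "induced j Cj i\<^sub>0 i\<^sub>1 \<nu> f r \<rho> h \<sigma>\<^sub>0 \<sigma>\<^sub>1 \<longleftrightarrow>
    h \<in> hom1 M Cj (trg M r) \<and>
    \<sigma>\<^sub>0 \<in> hom2 M r (h \<odot> i\<^sub>0) \<and> invertible2 M \<sigma>\<^sub>0 \<and>
    \<sigma>\<^sub>1 \<in> hom2 M (h \<odot> i\<^sub>1) f \<and> invertible2 M \<sigma>\<^sub>1 \<and>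
    \<rho> = \<sigma>\<^sub>1 \<cdot> whisker_nu j i\<^sub>0 \<nu> h \<cdot> (\<sigma>\<^sub>0 \<star> id2 M j)"


subsection \<open>Lax limits and compatibility of collages\<close>

text \<open>The category of triples \<open>(a : Y \<rightarrow> A, j \<odot> a \<Rightarrow> b, b : Y \<rightarrow> B)\<close>, where \<open>j : A \<rightarrow> B\<close>:\<close>

definition cone_cat ::
  "'m \<Rightarrow> 'o \<Rightarrow> ('m \<times> 't \<times> 'm, ('m \<times> 't \<times> 'm) \<times> ('t \<times> 't) \<times> ('m \<times> 't \<times> 'm)) cat" where
  "cone_cat j Y =
    comma (hom_cat M Y (src M j)) (hom_cat M Y (trg M j)) (hom_cat M Y (trg M j))
      (postcomp j) id_func"

definition cone_func ::
  "'m \<Rightarrow> 'm \<Rightarrow> 'm \<Rightarrow> 't \<Rightarrow>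
    ('m, 't, 'm \<times> 't \<times> 'm, ('m \<times> 't \<times> 'm) \<times> ('t \<times> 't) \<times> ('m \<times> 't \<times> 'm)) func" where
  "cone_func j p q \<mu> =
    (let F = (\<lambda>k. (p \<odot> k, (\<mu> \<star> id2 M k) \<cdot> inv2 M (assoc M j p k), q \<odot> k))
     in \<lparr>fobj = F,
         farr = (\<lambda>\<theta>. (F (dom2 M \<theta>), (id2 M p \<star> \<theta>, id2 M q \<star> \<theta>), F (cod2 M \<theta>)))\<rparr>)"

definition lax_limit :: "'m \<Rightarrow> 'o \<Rightarrow> 'm \<Rightarrow> 'm \<Rightarrow> 't \<Rightarrow> bool" where
  "lax_limit j L p q \<mu> \<longleftrightarrow>
    j \<in> Mor M \<and> L \<in> Ob M \<and> p \<in> hom1 M L (src M j) \<and> q \<in> hom1 M L (trg M j) \<and>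
    \<mu> \<in> hom2 M (j \<odot> p) q \<and>
    (\<forall>Y \<in> Ob M. is_equivalence (hom_cat M Y L) (cone_cat j Y) (cone_func j p q \<mu>))"

text \<open>
  The mate \<open>j \<odot> u\<^sub>1 \<Rightarrow> u\<^sub>0\<close> of \<open>\<nu> : i\<^sub>0 \<odot> j \<Rightarrow> i\<^sub>1\<close> under adjunctions \<open>i\<^sub>0 \<stileturn> u\<^sub>0\<close> with unit \<open>\<eta>\<^sub>0\<close>
  and \<open>i\<^sub>1 \<stileturn> u\<^sub>1\<close> with counit \<open>\<epsilon>\<^sub>1\<close>. Modulo coherence it is the composite
  \<open>j u\<^sub>1 \<Rightarrow> u\<^sub>0 i\<^sub>0 j u\<^sub>1 \<Rightarrow> u\<^sub>0 i\<^sub>1 u\<^sub>1 \<Rightarrow> u\<^sub>0\<close> of \<open>\<eta>\<^sub>0\<close>, \<open>\<nu>\<close> and \<open>\<epsilon>\<^sub>1\<close>.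
\<close>

definition mate :: "'m \<Rightarrow> 'm \<Rightarrow> 't \<Rightarrow> 'm \<Rightarrow> 't \<Rightarrow> 'm \<Rightarrow> 't \<Rightarrow> 't" where
  "mate j i\<^sub>0 \<nu> u\<^sub>0 \<eta>\<^sub>0 u\<^sub>1 \<epsilon>\<^sub>1 =
    runit M u\<^sub>0 \<cdot> (id2 M u\<^sub>0 \<star> \<epsilon>\<^sub>1) \<cdot> (id2 M u\<^sub>0 \<star> (\<nu> \<star> id2 M u\<^sub>1)) \<cdot>
    (id2 M u\<^sub>0 \<star> inv2 M (assoc M i\<^sub>0 j u\<^sub>1)) \<cdot> assoc M u\<^sub>0 i\<^sub>0 (j \<odot> u\<^sub>1) \<cdot>
    (\<eta>\<^sub>0 \<star> id2 M (j \<odot> u\<^sub>1)) \<cdot> inv2 M (lunit M (j \<odot> u\<^sub>1))"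

definition compatible :: "'m set \<Rightarrow> 'm \<Rightarrow> 'o \<Rightarrow> 'm \<Rightarrow> 'm \<Rightarrow> 't \<Rightarrow> bool" where
  "compatible K j Cj i\<^sub>0 i\<^sub>1 \<nu> \<longleftrightarrow>
    i\<^sub>0 \<in> K \<and> i\<^sub>1 \<in> K \<and>
    (\<forall>X \<in> Ob M. \<forall>h \<in> hom1 M Cj X. h \<odot> i\<^sub>0 \<in> K \<and> h \<odot> i\<^sub>1 \<in> K \<longrightarrow> h \<in> K) \<and>
    (\<exists>u\<^sub>0 \<eta>\<^sub>0 \<epsilon>\<^sub>0 u\<^sub>1 \<eta>\<^sub>1 \<epsilon>\<^sub>1. adjunction i\<^sub>0 u\<^sub>0 \<eta>\<^sub>0 \<epsilon>\<^sub>0 \<and> adjunction i\<^sub>1 u\<^sub>1 \<eta>\<^sub>1 \<epsilon>\<^sub>1 \<and>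
      lax_limit j Cj u\<^sub>1 u\<^sub>0 (mate j i\<^sub>0 \<nu> u\<^sub>0 \<eta>\<^sub>0 u\<^sub>1 \<epsilon>\<^sub>1))"

end

end

theory Submission
  imports Defs
begin

text \<open>
  By full faithfulness of \<open>h \<mapsto> (h i\<^sub>0, h \<nu>, h i\<^sub>1)\<close>, 2-morphisms \<open>k \<Rightarrow> \<langle>r, \<rho>\<rangle>\<close> are pairs
  \<open>(\<theta> : k i\<^sub>0 \<Rightarrow> r, \<phi> : k i\<^sub>1 \<Rightarrow> f)\<close> with \<open>\<rho> \<cdot> (\<theta> j) = \<phi> \<cdot> k \<nu>\<close>. If \<open>\<rho>\<close> is a right extension,
  then \<open>\<phi>\<close> determines \<open>\<theta>\<close>, so that such pairs amount to 2-morphisms \<open>k i\<^sub>1 \<Rightarrow> f\<close>: this is (ii).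
  For (i), essential surjectivity provides for each \<open>g : B \<rightarrow> X\<close> some \<open>k\<close> whose cocone is
  isomorphic to \<open>(g, 1, g j)\<close>; for this \<open>k\<close> it is \<open>\<theta>\<close> that determines \<open>\<phi>\<close>, so that the pairs
  amount to 2-morphisms \<open>g \<Rightarrow> r\<close>, whereas the right extension along \<open>i\<^sub>1\<close> identifies them with
  2-morphisms \<open>g j \<Rightarrow> f\<close>.
\<close>

section \<open>Equivalences of categories\<close>

lemma (in category) iso_arrow_cancel_left:
  assumes i: "iso_arrow C i" "i \<in> arrows C y z"
    and u: "u \<in> arrows C x y" and v: "v \<in> arrows C x y"
    and eq: "Comp C i u = Comp C i v"
  shows "u = v"
proof -
  obtain g where g: "g \<in> arrows C z y" "Comp C g i = Ident C y"
    using i unfolding iso_arrow_def arrows_def by auto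
  have "Comp C g (Comp C i u) = u" "Comp C g (Comp C i v) = v"
    using Comp_assoc[OF u i(2) g(1)] Comp_assoc[OF v i(2) g(1)] Ident_left[OF u] Ident_left[OF v]
      g(2) by simp_all
  then show ?thesis using eq by metis
qed

lemma (in category) iso_arrow_cancel_right:
  assumes i: "iso_arrow C i" "i \<in> arrows C w x"
    and u: "u \<in> arrows C x y" and v: "v \<in> arrows C x y"
    and eq: "Comp C u i = Comp C v i"
  shows "u = v"
proof -
  obtain g where g: "g \<in> arrows C x w" "Comp C i g = Ident C x"
    using i unfolding iso_arrow_def arrows_def by auto
  have "Comp C (Comp C u i) g = u" "Comp C (Comp C v i) g = v"
    using Comp_assoc[OF g(1) i(2) u] Comp_assoc[OF g(1) i(2) v] Ident_right[OF u] Ident_right[OF v]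
      g(2) by simp_all
  then show ?thesis using eq by metis
qed

lemma is_functor_farr:
  "is_functor C D F \<Longrightarrow> u \<in> arrows C x y \<Longrightarrow> farr F u \<in> arrows D (fobj F x) (fobj F y)"
  unfolding is_functor_def by blast

lemma arrows_Obj:
  assumes "category C" "u \<in> arrows C x y"
  shows "x \<in> Obj C" "y \<in> Obj C"
  using assms category.Dom_Obj category.Cod_Obj unfolding arrows_def by fastforce+

text \<open>Naturality equates \<eta> y after u with G (F u) after \<eta> x, so the left-hand side
  depends on u only through G (F u), and the isomorphism \<eta> y can be cancelled.\<close>

lemma natural_iso_faithful:
  assumes \<eta>: "natural_iso C C id_func (comp_func G F) \<eta>"
    and u: "u \<in> arrows C x y" and v: "v \<in> arrows C x y"
    and eq: "farr G (farr F u) = farr G (farr F v)"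
  shows "u = v"
proof -
  interpret C: category C using \<eta> unfolding natural_iso_def is_functor_def by blast
  have y: "y \<in> Obj C" using arrows_Obj[OF C.category_axioms u] by blast
  have "Comp C (\<eta> y) u = Comp C (\<eta> y) v"
    using \<eta> u v eq unfolding natural_iso_def id_func_def comp_func_def by auto
  moreover have "iso_arrow C (\<eta> y)" "\<eta> y \<in> arrows C y (fobj G (fobj F y))"
    using \<eta> y unfolding natural_iso_def id_func_def comp_func_def by auto
  ultimately show ?thesis using C.iso_arrow_cancel_left u v by blast
qed

text \<open>The counterpart for \<epsilon>, which points towards the identity: naturality expresses
  u after \<epsilon> x through G u, and now \<epsilon> x is cancelled on the right.\<close>

lemma natural_iso_id_faithful:
  assumes \<epsilon>: "natural_iso D D (comp_func F G) id_func \<epsilon>"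
    and u: "u \<in> arrows D x y" and v: "v \<in> arrows D x y"
    and eq: "farr G u = farr G v"
  shows "u = v"
proof -
  interpret D: category D using \<epsilon> unfolding natural_iso_def is_functor_def by blast
  have x: "x \<in> Obj D" using arrows_Obj[OF D.category_axioms u] by blast
  have n: "Comp D (\<epsilon> y) (farr F (farr G w)) = Comp D w (\<epsilon> x)" if "w \<in> arrows D x y" for w
    using \<epsilon> that unfolding natural_iso_def id_func_def comp_func_def by auto
  have "Comp D u (\<epsilon> x) = Comp D v (\<epsilon> x)"
    using n[OF u] n[OF v] eq by simp
  moreover have "iso_arrow D (\<epsilon> x)" "\<epsilon> x \<in> arrows D (fobj F (fobj G x)) x"
    using \<epsilon> x unfolding natural_iso_def id_func_def comp_func_def by auto
  ultimately show ?thesis using D.iso_arrow_cancel_right u v by blast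
qed

text \<open>The preimage of w is the inverse of \<eta> y after G w after \<eta> x. The definition of
  equivalence relates \<eta> and \<epsilon> by no triangle identities, so F u = w is shown after
  applying G, which is faithful thanks to \<epsilon>.\<close>

lemma is_equivalence_fully_faithful:
  assumes F: "is_equivalence C D F" and x: "x \<in> Obj C" and y: "y \<in> Obj C"
    and w: "w \<in> arrows D (fobj F x) (fobj F y)"
  shows "\<exists>!u. u \<in> arrows C x y \<and> farr F u = w"
proof -
  obtain G \<eta> \<epsilon> where G: "is_functor D C G"
    and \<eta>: "natural_iso C C id_func (comp_func G F) \<eta>"
    and \<epsilon>: "natural_iso D D (comp_func F G) id_func \<epsilon>"
    using F unfolding is_equivalence_def by blast
  have FF: "is_functor C D F" using F unfolding is_equivalence_def by blast
  interpret C: category C using G unfolding is_functor_def by blast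
  let ?T = "\<lambda>x. fobj G (fobj F x)"
  have \<eta>_iso: "iso_arrow C (\<eta> z)" "\<eta> z \<in> arrows C z (?T z)" if "z \<in> Obj C" for z
    using \<eta> that unfolding natural_iso_def id_func_def comp_func_def by auto
  obtain g where g: "g \<in> arrows C (?T y) y" "Comp C (\<eta> y) g = Ident C (?T y)"
    using \<eta>_iso[OF y] unfolding iso_arrow_def arrows_def by auto
  have Gw: "farr G w \<in> arrows C (?T x) (?T y)"
    using is_functor_farr[OF G w] .
  define u where "u = Comp C g (Comp C (farr G w) (\<eta> x))"
  have Gw\<eta>: "Comp C (farr G w) (\<eta> x) \<in> arrows C x (?T y)"
    using C.Comp_arrow[OF \<eta>_iso(2)[OF x] Gw] .
  have u: "u \<in> arrows C x y"
    unfolding u_def using C.Comp_arrow[OF Gw\<eta> g(1)] .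
  have Fu: "farr F u \<in> arrows D (fobj F x) (fobj F y)"
    using is_functor_farr[OF FF u] .
  \<comment> \<open>Naturality of \<eta> at u; as g inverts \<eta> y, this composite is also G w
    after \<eta> x, and \<eta> x cancels.\<close>
  have "Comp C (farr G (farr F u)) (\<eta> x) = Comp C (\<eta> y) u"
    using \<eta> u unfolding natural_iso_def id_func_def comp_func_def by auto
  also have "\<dots> = Comp C (farr G w) (\<eta> x)"
    unfolding u_def
    using C.Comp_assoc[OF Gw\<eta> g(1) \<eta>_iso(2)[OF y]] C.Ident_left[OF Gw\<eta>] g(2) by simp
  finally have "farr G (farr F u) = farr G w"
    using C.iso_arrow_cancel_right[OF \<eta>_iso[OF x]] is_functor_farr[OF G Fu] Gw by blast
  then have "farr F u = w"
    using natural_iso_id_faithful[OF \<epsilon> Fu w] by blast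
  then show ?thesis
    using u natural_iso_faithful[OF \<eta>] by metis
qed

lemma is_equivalence_essentially_surjective:
  assumes "is_equivalence C D F" "d \<in> Obj D"
  obtains c e where "c \<in> Obj C" "e \<in> arrows D (fobj F c) d" "iso_arrow D e"
proof -
  obtain G \<epsilon> where G: "is_functor D C G"
    and \<epsilon>: "natural_iso D D (comp_func F G) id_func \<epsilon>"
    using assms(1) unfolding is_equivalence_def by blast
  show ?thesis
  proof
    show "fobj G d \<in> Obj C" using G assms(2) unfolding is_functor_def by blast
    show "\<epsilon> d \<in> arrows D (fobj F (fobj G d)) d" "iso_arrow D (\<epsilon> d)"
      using \<epsilon> assms(2) unfolding natural_iso_def id_func_def comp_func_def by auto
  qed
qed

section \<open>Comma categories\<close>

lemma comma_Obj_iff: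
  "(c, e, d) \<in> Obj (comma C D E F G) \<longleftrightarrow>
    c \<in> Obj C \<and> d \<in> Obj D \<and> e \<in> arrows E (fobj F c) (fobj G d)"
  unfolding comma_def by simp

lemma comma_arrow_iff:
  "t \<in> arrows (comma C D E F G) (c, e, d) (c', e', d') \<longleftrightarrow>
    (\<exists>u v. t = ((c, e, d), (u, v), (c', e', d')) \<and>
      (c, e, d) \<in> Obj (comma C D E F G) \<and> (c', e', d') \<in> Obj (comma C D E F G) \<and>
      u \<in> arrows C c c' \<and> v \<in> arrows D d d' \<and>
      Comp E e' (farr F u) = Comp E (farr G v) e)"
  unfolding comma_def arrows_def by auto

text \<open>Composition in a comma category is componentwise, so an inverse has an inverse of u as
  its first component. Only the one-sided identity used in \<open>collage_presentation\<close> is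
  recorded.\<close>

lemma comma_iso_arrowE:
  assumes "iso_arrow (comma C D E F G) ((c, e, d), (u, v), (c', e', d'))"
    (is "iso_arrow ?K ?t")
  obtains u' where "u' \<in> arrows C c' c" "Comp C u u' = Ident C c'"
proof -
  have "Dom ?K ?t = (c, e, d)" "Cod ?K ?t = (c', e', d')"
    unfolding comma_def by simp_all
  then obtain t' where t': "t' \<in> arrows ?K (c', e', d') (c, e, d)"
    and inv: "Comp ?K ?t t' = Ident ?K (c', e', d')"
    using assms unfolding iso_arrow_def by auto
  obtain u' v' where "t' = ((c', e', d'), (u', v'), (c, e, d))" "u' \<in> arrows C c' c"
    using t' unfolding comma_arrow_iff by blast
  then show ?thesis
    using that inv unfolding comma_def by simp
qed

section \<open>Calculus of 2-morphisms in a bicategory\<close>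

context bicategory
begin

lemma hom2_Mor:
  assumes "\<alpha> \<in> hom2 M f g"
  shows "f \<in> Mor M" "g \<in> Mor M"
  using assms dom2_Mor cod2_Mor unfolding hom2_def by auto

lemma hom2_hom1:
  assumes "\<alpha> \<in> hom2 M f g"
  shows "f \<in> hom1 M (src M f) (trg M f)" "g \<in> hom1 M (src M f) (trg M f)"
  using assms dom2_Mor cod2_Mor src_parallel trg_parallel unfolding hom1_def hom2_def by auto

lemma hom2_hom1_iff:
  assumes "\<alpha> \<in> hom2 M f g"
  shows "f \<in> hom1 M A B \<longleftrightarrow> g \<in> hom1 M A B"
  using hom2_hom1[OF assms] unfolding hom1_def by auto

lemma category_hom_Mor:
  assumes "f \<in> Mor M"
  shows "category (hom_cat M (src M f) (trg M f))"
  using assms src_Ob trg_Ob category_hom by blast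

text \<open>Source and target of either end of a 2-morphism fix those of the other, so knowing one
  end to lie in \<open>hom1\<close> suffices.\<close>

lemma arrows_hom_cat:
  assumes "f \<in> hom1 M A B"
  shows "arrows (hom_cat M A B) f g = hom2 M f g" "arrows (hom_cat M A B) g f = hom2 M g f"
  using assms hom2_hom1_iff unfolding arrows_def hom_cat_def hom2_def by auto

lemma hom_cat_simps [simp]:
  "Obj (hom_cat M A B) = hom1 M A B"
  "Ident (hom_cat M A B) = id2 M"
  "Comp (hom_cat M A B) = vcomp M"
  unfolding hom_cat_def by simp_all

lemma id2_hom:
  assumes "f \<in> Mor M"
  shows "id2 M f \<in> hom2 M f f"
proof -
  have f: "f \<in> hom1 M (src M f) (trg M f)" using assms unfolding hom1_def by simp
  show ?thesis
    using category.Ident_arrow[OF category_hom_Mor[OF assms]] f arrows_hom_cat[OF f] by auto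
qed

lemma vcomp_hom:
  assumes "\<alpha> \<in> hom2 M f g" "\<beta> \<in> hom2 M g h"
  shows "\<beta> \<cdot> \<alpha> \<in> hom2 M f h"
  using category.Comp_arrow[OF category_hom_Mor[OF hom2_Mor(1)[OF assms(1)]], of \<alpha> f g \<beta> h]
    hom2_hom1[OF assms(1)] assms arrows_hom_cat by auto

lemma vcomp_assoc:
  assumes "\<alpha> \<in> hom2 M f g" "\<beta> \<in> hom2 M g h" "\<gamma> \<in> hom2 M h k"
  shows "(\<gamma> \<cdot> \<beta>) \<cdot> \<alpha> = \<gamma> \<cdot> \<beta> \<cdot> \<alpha>"
proof -
  let ?H = "hom_cat M (src M f) (trg M f)"
  have "\<alpha> \<in> arrows ?H f g" "\<beta> \<in> arrows ?H g h" "\<gamma> \<in> arrows ?H h k"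
    using assms hom2_hom1[OF assms(1)] hom2_hom1_iff[OF assms(2)] arrows_hom_cat by blast+
  then show ?thesis
    using category.Comp_assoc[OF category_hom_Mor[OF hom2_Mor(1)[OF assms(1)]]] by fastforce
qed

lemma id2_left:
  assumes "\<alpha> \<in> hom2 M f g"
  shows "id2 M g \<cdot> \<alpha> = \<alpha>"
  using category.Ident_left[OF category_hom_Mor[OF hom2_Mor(1)[OF assms]], of \<alpha> f g]
    hom2_hom1[OF assms] assms arrows_hom_cat by auto

lemma id2_right:
  assumes "\<alpha> \<in> hom2 M f g"
  shows "\<alpha> \<cdot> id2 M f = \<alpha>"
  using category.Ident_right[OF category_hom_Mor[OF hom2_Mor(1)[OF assms]], of \<alpha> f g]
    hom2_hom1[OF assms] assms arrows_hom_cat by auto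

lemma invertible2E:
  assumes "invertible2 M \<alpha>" "\<alpha> \<in> hom2 M f g"
  obtains \<beta> where "\<beta> \<in> hom2 M g f" "\<beta> \<cdot> \<alpha> = id2 M f" "\<alpha> \<cdot> \<beta> = id2 M g"
  using assms unfolding invertible2_def inverse2_def hom2_def by auto

lemma vcomp_cancel_left:
  assumes "\<alpha> \<in> hom2 M f g" "\<beta> \<in> hom2 M g h" "\<gamma> \<in> hom2 M h g" "\<gamma> \<cdot> \<beta> = id2 M g"
  shows "\<gamma> \<cdot> \<beta> \<cdot> \<alpha> = \<alpha>"
  using assms vcomp_assoc id2_left by metis

lemma vcomp_cancel_right:
  assumes "\<alpha> \<in> hom2 M g h" "\<beta> \<in> hom2 M f g" "\<gamma> \<in> hom2 M g f" "\<beta> \<cdot> \<gamma> = id2 M g"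
  shows "(\<alpha> \<cdot> \<beta>) \<cdot> \<gamma> = \<alpha>"
  using assms vcomp_assoc id2_right by metis

lemma whisker_hom:
  assumes "j \<in> hom1 M A B" "g \<in> hom1 M B X" "\<theta> \<in> hom2 M g g'"
  shows "\<theta> \<star> id2 M j \<in> hom2 M (g \<odot> j) (g' \<odot> j)"
  using hcomp_hom[OF assms(1,2) id2_hom assms(3)] assms(1) unfolding hom1_def by blast

lemma whisker_vcomp:
  assumes "j \<in> hom1 M A B" "g \<in> hom1 M B X" "\<theta> \<in> hom2 M g g'" "\<theta>' \<in> hom2 M g' g''"
  shows "(\<theta>' \<cdot> \<theta>) \<star> id2 M j = (\<theta>' \<star> id2 M j) \<cdot> (\<theta> \<star> id2 M j)"
proof -
  have "id2 M j \<in> hom2 M j j" using assms(1) id2_hom unfolding hom1_def by blast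
  then show ?thesis
    using interchange[OF assms(1,2) _ _ assms(3,4)] id2_left by metis
qed

lemma whisker_nu_hom:
  assumes "j \<in> hom1 M A B" "i\<^sub>0 \<in> hom1 M B C" "\<nu> \<in> hom2 M (i\<^sub>0 \<odot> j) i\<^sub>1" "h \<in> hom1 M C X"
  shows "whisker_nu j i\<^sub>0 \<nu> h \<in> hom2 M ((h \<odot> i\<^sub>0) \<odot> j) (h \<odot> i\<^sub>1)"
proof -
  have "id2 M h \<star> \<nu> \<in> hom2 M (h \<odot> (i\<^sub>0 \<odot> j)) (h \<odot> i\<^sub>1)"
    using hcomp_hom[OF comp1_hom[OF assms(1,2)] assms(4,3) id2_hom] assms(4)
    unfolding hom1_def by blast
  then show ?thesis
    unfolding whisker_nu_def using vcomp_hom assoc_hom[OF assms(1,2,4)] by blast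
qed

section \<open>Cocones under j and the induced 1-morphism\<close>

lemma cocone_cat_Obj:
  assumes "j \<in> hom1 M A B"
  shows "(r, \<rho>, f) \<in> Obj (cocone_cat j X) \<longleftrightarrow>
    r \<in> hom1 M B X \<and> f \<in> hom1 M A X \<and> \<rho> \<in> hom2 M (r \<odot> j) f"
proof -
  have j: "src M j = A" "trg M j = B" using assms unfolding hom1_def by auto
  show ?thesis
    unfolding cocone_cat_def comma_Obj_iff j precomp_def id_func_def
    using arrows_hom_cat(2) by auto
qed

lemma cocone_cat_arrow:
  assumes "j \<in> hom1 M A B"
  shows "t \<in> arrows (cocone_cat j X) (r, \<rho>, f) (r', \<rho>', f') \<longleftrightarrow>
    (\<exists>\<theta> \<phi>. t = ((r, \<rho>, f), (\<theta>, \<phi>), (r', \<rho>', f')) \<and>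
      (r, \<rho>, f) \<in> Obj (cocone_cat j X) \<and> (r', \<rho>', f') \<in> Obj (cocone_cat j X) \<and>
      \<theta> \<in> hom2 M r r' \<and> \<phi> \<in> hom2 M f f' \<and> \<rho>' \<cdot> (\<theta> \<star> id2 M j) = \<phi> \<cdot> \<rho>)"
proof -
  have j: "src M j = A" "trg M j = B" using assms unfolding hom1_def by auto
  have "arrows (hom_cat M B X) r r' = hom2 M r r'" "arrows (hom_cat M A X) f f' = hom2 M f f'"
    if "(r, \<rho>, f) \<in> Obj (cocone_cat j X)"
    using that arrows_hom_cat(1) unfolding cocone_cat_Obj[OF assms] by blast+
  then show ?thesis
    unfolding cocone_cat_def comma_arrow_iff j by (auto simp: precomp_def id_func_def)
qed

end

text \<open>\<open>h\<close>, \<open>\<sigma>\<^sub>0\<close> and \<open>\<sigma>\<^sub>1\<close>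
  are any data satisfying \<open>induced\<close>, so the results hold for every choice of the
  induced 1-morphism. No class \<open>K\<close> is fixed, because right extensions are tested
  against all 1-morphisms of \<open>M\<close>.\<close>

locale collage_cocone = bicategory M
  for M :: "('o, 'm, 't) bicat" (structure) +
  fixes A B X Cj :: 'o and j f r i\<^sub>0 i\<^sub>1 h :: 'm and \<rho> \<nu> \<sigma>\<^sub>0 \<sigma>\<^sub>1 :: 't
  assumes j: "j \<in> hom1 M A B" and f: "f \<in> hom1 M A X" and r: "r \<in> hom1 M B X"
    and collage: "collage j Cj i\<^sub>0 i\<^sub>1 \<nu>"
    and induced: "induced j Cj i\<^sub>0 i\<^sub>1 \<nu> f r \<rho> h \<sigma>\<^sub>0 \<sigma>\<^sub>1"
begin

abbreviation W :: "'m \<Rightarrow> 't" where "W \<equiv> whisker_nu j i\<^sub>0 \<nu>"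

lemma i0: "i\<^sub>0 \<in> hom1 M B Cj" and i1: "i\<^sub>1 \<in> hom1 M A Cj"
  and nu: "\<nu> \<in> hom2 M (i\<^sub>0 \<odot> j) i\<^sub>1"
  using collage j unfolding collage_def hom1_def by auto

lemma X_Ob: "X \<in> Ob M"
  using f trg_Ob unfolding hom1_def by blast

lemma equivalence: "is_equivalence (hom_cat M Cj X) (cocone_cat j X) (collage_func j i\<^sub>0 i\<^sub>1 \<nu>)"
  using collage X_Ob unfolding collage_def by blast

lemma h: "h \<in> hom1 M Cj X"
  and sigma0: "\<sigma>\<^sub>0 \<in> hom2 M r (h \<odot> i\<^sub>0)" "invertible2 M \<sigma>\<^sub>0"
  and sigma1: "\<sigma>\<^sub>1 \<in> hom2 M (h \<odot> i\<^sub>1) f" "invertible2 M \<sigma>\<^sub>1"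
  and rho_eq: "\<rho> = \<sigma>\<^sub>1 \<cdot> W h \<cdot> (\<sigma>\<^sub>0 \<star> id2 M j)"
  using induced r unfolding induced_def hom1_def by auto

section \<open>2-morphisms out of a 1-morphism on the collage\<close>

lemma W_hom: "k \<in> hom1 M Cj X \<Longrightarrow> W k \<in> hom2 M ((k \<odot> i\<^sub>0) \<odot> j) (k \<odot> i\<^sub>1)"
  using whisker_nu_hom[OF j i0 nu] .

text \<open>This is the compatibility square of the arrow to which \<open>collage_func\<close> sends
  \<tau>. It is read off from functoriality, which is part of the equivalence, instead of being
  computed from coherence.\<close>

lemma W_natural:
  assumes "k \<in> hom1 M Cj X" "\<tau> \<in> hom2 M k k'"
  shows "W k' \<cdot> ((\<tau> \<star> id2 M i\<^sub>0) \<star> id2 M j) = (\<tau> \<star> id2 M i\<^sub>1) \<cdot> W k"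
proof -
  \<comment> \<open>The ends are recorded because the arrow part of \<open>collage_func\<close>
    reads them off \<open>dom2\<close> and \<open>cod2\<close>.\<close>
  have \<tau>: "\<tau> \<in> arrows (hom_cat M Cj X) k k'" "dom2 M \<tau> = k" "cod2 M \<tau> = k'"
    using assms arrows_hom_cat unfolding hom2_def by auto
  have "is_functor (hom_cat M Cj X) (cocone_cat j X) (collage_func j i\<^sub>0 i\<^sub>1 \<nu>)"
    using equivalence unfolding is_equivalence_def by blast
  from is_functor_farr[OF this \<tau>(1)] show ?thesis
    unfolding collage_func_def Let_def by (simp add: cocone_cat_arrow[OF j] \<tau>)
qed

lemma collage_func_fobj: "fobj (collage_func j i\<^sub>0 i\<^sub>1 \<nu>) k = (k \<odot> i\<^sub>0, W k, k \<odot> i\<^sub>1)"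
  unfolding collage_func_def Let_def by simp

text \<open>The square \<open>eq\<close> says that (\<theta>, \<phi>) is an arrow between the
  cocones of k and k', and full faithfulness lifts it uniquely.\<close>

lemma collage_cell:
  assumes k: "k \<in> hom1 M Cj X" and k': "k' \<in> hom1 M Cj X"
    and \<theta>: "\<theta> \<in> hom2 M (k \<odot> i\<^sub>0) (k' \<odot> i\<^sub>0)" and \<phi>: "\<phi> \<in> hom2 M (k \<odot> i\<^sub>1) (k' \<odot> i\<^sub>1)"
    and eq: "W k' \<cdot> (\<theta> \<star> id2 M j) = \<phi> \<cdot> W k"
  shows "\<exists>!\<tau>. \<tau> \<in> hom2 M k k' \<and> \<tau> \<star> id2 M i\<^sub>0 = \<theta> \<and> \<tau> \<star> id2 M i\<^sub>1 = \<phi>"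
proof -
  let ?F = "collage_func j i\<^sub>0 i\<^sub>1 \<nu>"
  let ?w = "(fobj ?F k, (\<theta>, \<phi>), fobj ?F k')"
  have "(l \<odot> i\<^sub>0, W l, l \<odot> i\<^sub>1) \<in> Obj (cocone_cat j X)" if "l \<in> hom1 M Cj X" for l
    unfolding cocone_cat_Obj[OF j] using that comp1_hom i0 i1 W_hom by blast
  then have "?w \<in> arrows (cocone_cat j X) (fobj ?F k) (fobj ?F k')"
    unfolding collage_func_fobj cocone_cat_arrow[OF j] using assms by blast
  then have "\<exists>!\<tau>. \<tau> \<in> arrows (hom_cat M Cj X) k k' \<and> farr ?F \<tau> = ?w"
    using is_equivalence_fully_faithful[OF equivalence] k k' by simp
  moreover have "farr ?F \<tau> = ?w \<longleftrightarrow> \<tau> \<star> id2 M i\<^sub>0 = \<theta> \<and> \<tau> \<star> id2 M i\<^sub>1 = \<phi>"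
    if "\<tau> \<in> hom2 M k k'" for \<tau>
    using that unfolding collage_func_def Let_def hom2_def by auto
  ultimately show ?thesis
    using arrows_hom_cat(1)[OF k] by metis
qed

text \<open>A 2-morphism \<open>\<tau> : k \<Rightarrow> h\<close> is encoded by \<open>\<theta>\<close> with \<open>\<sigma>\<^sub>0 \<cdot> \<theta> = \<tau> i\<^sub>0\<close> and by \<open>\<sigma>\<^sub>1 \<cdot> \<tau> i\<^sub>1\<close>.\<close>

lemma induced_cell_restrict:
  assumes k: "k \<in> hom1 M Cj X" and \<tau>: "\<tau> \<in> hom2 M k h"
  obtains \<theta> where "\<theta> \<in> hom2 M (k \<odot> i\<^sub>0) r" "\<sigma>\<^sub>0 \<cdot> \<theta> = \<tau> \<star> id2 M i\<^sub>0"
    "\<rho> \<cdot> (\<theta> \<star> id2 M j) = (\<sigma>\<^sub>1 \<cdot> (\<tau> \<star> id2 M i\<^sub>1)) \<cdot> W k"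
proof -
  obtain \<sigma>' where \<sigma>': "\<sigma>' \<in> hom2 M (h \<odot> i\<^sub>0) r" "\<sigma>\<^sub>0 \<cdot> \<sigma>' = id2 M (h \<odot> i\<^sub>0)"
    using invertible2E[OF sigma0(2,1)] by metis
  have \<tau>0: "\<tau> \<star> id2 M i\<^sub>0 \<in> hom2 M (k \<odot> i\<^sub>0) (h \<odot> i\<^sub>0)"
    and \<tau>1: "\<tau> \<star> id2 M i\<^sub>1 \<in> hom2 M (k \<odot> i\<^sub>1) (h \<odot> i\<^sub>1)"
    using whisker_hom i0 i1 k \<tau> by blast+
  define \<theta> where "\<theta> = \<sigma>' \<cdot> (\<tau> \<star> id2 M i\<^sub>0)"
  have \<theta>: "\<theta> \<in> hom2 M (k \<odot> i\<^sub>0) r"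
    unfolding \<theta>_def using vcomp_hom[OF \<tau>0 \<sigma>'(1)] .
  have \<sigma>\<theta>: "\<sigma>\<^sub>0 \<cdot> \<theta> = \<tau> \<star> id2 M i\<^sub>0"
    unfolding \<theta>_def using vcomp_cancel_left[OF \<tau>0 \<sigma>'(1) sigma0(1) \<sigma>'(2)] .
  have ki0: "k \<odot> i\<^sub>0 \<in> hom1 M B X" using comp1_hom[OF i0 k] .
  have \<theta>j: "\<theta> \<star> id2 M j \<in> hom2 M ((k \<odot> i\<^sub>0) \<odot> j) (r \<odot> j)"
    using whisker_hom[OF j ki0 \<theta>] .
  have \<sigma>j: "\<sigma>\<^sub>0 \<star> id2 M j \<in> hom2 M (r \<odot> j) ((h \<odot> i\<^sub>0) \<odot> j)"
    using whisker_hom[OF j r sigma0(1)] .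
  have "\<rho> \<cdot> (\<theta> \<star> id2 M j) = \<sigma>\<^sub>1 \<cdot> W h \<cdot> (\<sigma>\<^sub>0 \<star> id2 M j) \<cdot> (\<theta> \<star> id2 M j)"
    unfolding rho_eq
    using vcomp_assoc[OF \<theta>j vcomp_hom[OF \<sigma>j W_hom[OF h]] sigma1(1)]
      vcomp_assoc[OF \<theta>j \<sigma>j W_hom[OF h]] by simp
  also have "(\<sigma>\<^sub>0 \<star> id2 M j) \<cdot> (\<theta> \<star> id2 M j) = (\<tau> \<star> id2 M i\<^sub>0) \<star> id2 M j"
    using whisker_vcomp[OF j ki0 \<theta> sigma0(1)] \<sigma>\<theta> by simp
  also have "W h \<cdot> \<dots> = (\<tau> \<star> id2 M i\<^sub>1) \<cdot> W k"
    using W_natural[OF k \<tau>] .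
  also have "\<sigma>\<^sub>1 \<cdot> \<dots> = (\<sigma>\<^sub>1 \<cdot> (\<tau> \<star> id2 M i\<^sub>1)) \<cdot> W k"
    using vcomp_assoc[OF W_hom[OF k] \<tau>1 sigma1(1)] by simp
  finally show ?thesis using that \<theta> \<sigma>\<theta> by blast
qed

text \<open>The converse of \<open>induced_cell_restrict\<close>: composing \<theta> with
  \<open>\<sigma>\<^sub>0\<close> and \<phi> with the inverse of \<open>\<sigma>\<^sub>1\<close>
  yields an arrow from the cocone of k to that of h, to which \<open>collage_cell\<close>
  applies.\<close>

lemma induced_cell:
  assumes k: "k \<in> hom1 M Cj X"
    and \<theta>: "\<theta> \<in> hom2 M (k \<odot> i\<^sub>0) r" and \<phi>: "\<phi> \<in> hom2 M (k \<odot> i\<^sub>1) f"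
    and eq: "\<rho> \<cdot> (\<theta> \<star> id2 M j) = \<phi> \<cdot> W k"
  shows "\<exists>!\<tau>. \<tau> \<in> hom2 M k h \<and> \<tau> \<star> id2 M i\<^sub>0 = \<sigma>\<^sub>0 \<cdot> \<theta> \<and> \<sigma>\<^sub>1 \<cdot> (\<tau> \<star> id2 M i\<^sub>1) = \<phi>"
proof -
  obtain \<sigma>' where \<sigma>': "\<sigma>' \<in> hom2 M f (h \<odot> i\<^sub>1)"
    "\<sigma>' \<cdot> \<sigma>\<^sub>1 = id2 M (h \<odot> i\<^sub>1)" "\<sigma>\<^sub>1 \<cdot> \<sigma>' = id2 M f"
    using invertible2E[OF sigma1(2,1)] by metis
  have ki0: "k \<odot> i\<^sub>0 \<in> hom1 M B X" using comp1_hom[OF i0 k] .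
  have \<theta>j: "\<theta> \<star> id2 M j \<in> hom2 M ((k \<odot> i\<^sub>0) \<odot> j) (r \<odot> j)"
    using whisker_hom[OF j ki0 \<theta>] .
  have \<sigma>j: "\<sigma>\<^sub>0 \<star> id2 M j \<in> hom2 M (r \<odot> j) ((h \<odot> i\<^sub>0) \<odot> j)"
    using whisker_hom[OF j r sigma0(1)] .
  have W\<sigma>\<theta>: "W h \<cdot> (\<sigma>\<^sub>0 \<star> id2 M j) \<cdot> (\<theta> \<star> id2 M j) \<in> hom2 M ((k \<odot> i\<^sub>0) \<odot> j) (h \<odot> i\<^sub>1)"
    using vcomp_hom \<theta>j \<sigma>j W_hom[OF h] by blast
  have "W h \<cdot> ((\<sigma>\<^sub>0 \<cdot> \<theta>) \<star> id2 M j) = W h \<cdot> (\<sigma>\<^sub>0 \<star> id2 M j) \<cdot> (\<theta> \<star> id2 M j)"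
    using whisker_vcomp[OF j ki0 \<theta> sigma0(1)] by simp
  \<comment> \<open>Inserting the identity as \<sigma>' after \<open>\<sigma>\<^sub>1\<close> makes
    the composite defining \<rho> appear, so that \<open>eq\<close> can be applied.\<close>
  also have "\<dots> = \<sigma>' \<cdot> \<sigma>\<^sub>1 \<cdot> \<dots>"
    using vcomp_cancel_left[OF W\<sigma>\<theta> sigma1(1) \<sigma>'(1,2)] by simp
  also have "\<sigma>\<^sub>1 \<cdot> W h \<cdot> (\<sigma>\<^sub>0 \<star> id2 M j) \<cdot> (\<theta> \<star> id2 M j) = \<rho> \<cdot> (\<theta> \<star> id2 M j)"
    unfolding rho_eq
    using vcomp_assoc[OF \<theta>j vcomp_hom[OF \<sigma>j W_hom[OF h]] sigma1(1)]
      vcomp_assoc[OF \<theta>j \<sigma>j W_hom[OF h]] by simp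
  also have "\<sigma>' \<cdot> \<dots> = (\<sigma>' \<cdot> \<phi>) \<cdot> W k"
    using eq vcomp_assoc[OF W_hom[OF k] \<phi> \<sigma>'(1)] by simp
  finally have "\<exists>!\<tau>. \<tau> \<in> hom2 M k h \<and> \<tau> \<star> id2 M i\<^sub>0 = \<sigma>\<^sub>0 \<cdot> \<theta> \<and> \<tau> \<star> id2 M i\<^sub>1 = \<sigma>' \<cdot> \<phi>"
    using collage_cell[OF k h vcomp_hom[OF \<theta> sigma0(1)] vcomp_hom[OF \<phi> \<sigma>'(1)]] by blast
  moreover have "\<tau> \<star> id2 M i\<^sub>1 = \<sigma>' \<cdot> \<phi> \<longleftrightarrow> \<sigma>\<^sub>1 \<cdot> (\<tau> \<star> id2 M i\<^sub>1) = \<phi>" if "\<tau> \<in> hom2 M k h" for \<tau>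
    using vcomp_cancel_left[OF whisker_hom[OF i1 k that] sigma1(1) \<sigma>'(1,2)]
      vcomp_cancel_left[OF \<phi> \<sigma>'(1) sigma1(1) \<sigma>'(3)] by metis
  ultimately show ?thesis by metis
qed

section \<open>Transfer of right extensions between j and \<open>i\<^sub>1\<close>\<close>

lemma rho: "\<rho> \<in> hom2 M (r \<odot> j) f"
  unfolding rho_eq using vcomp_hom whisker_hom[OF j r sigma0(1)] W_hom[OF h] sigma1(1) by blast

lemma right_extension_j_iff:
  "right_extension j f r \<rho> \<longleftrightarrow> (\<forall>g \<in> hom1 M B X.
    bij_betw (\<lambda>\<theta>. \<rho> \<cdot> (\<theta> \<star> id2 M j)) (hom2 M g r) (hom2 M (g \<odot> j) f))"
  using j f r rho unfolding right_extension_def hom1_def by auto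

lemma right_extension_i1_iff:
  "right_extension i\<^sub>1 f h \<sigma>\<^sub>1 \<longleftrightarrow> (\<forall>k \<in> hom1 M Cj X.
    bij_betw (\<lambda>\<tau>. \<sigma>\<^sub>1 \<cdot> (\<tau> \<star> id2 M i\<^sub>1)) (hom2 M k h) (hom2 M (k \<odot> i\<^sub>1) f))"
  using i1 f h sigma1 unfolding right_extension_def hom1_def by auto

text \<open>Given \<phi>, the universal property of \<rho> at \<open>k \<odot> i\<^sub>0\<close> has
  exactly one \<theta> matching \<open>\<phi> \<cdot> W k\<close>, and by
  \<open>induced_cell\<close> the pair (\<theta>, \<phi>) is exactly one \<tau>.\<close>

lemma right_extension_i1:
  assumes "right_extension j f r \<rho>"
  shows "right_extension i\<^sub>1 f h \<sigma>\<^sub>1"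
  unfolding right_extension_i1_iff
proof
  fix k assume k: "k \<in> hom1 M Cj X"
  have ki0: "k \<odot> i\<^sub>0 \<in> hom1 M B X" using comp1_hom[OF i0 k] .
  have bij: "bij_betw (\<lambda>\<theta>. \<rho> \<cdot> (\<theta> \<star> id2 M j)) (hom2 M (k \<odot> i\<^sub>0) r) (hom2 M ((k \<odot> i\<^sub>0) \<odot> j) f)"
    using assms ki0 unfolding right_extension_j_iff by blast
  show "bij_betw (\<lambda>\<tau>. \<sigma>\<^sub>1 \<cdot> (\<tau> \<star> id2 M i\<^sub>1)) (hom2 M k h) (hom2 M (k \<odot> i\<^sub>1) f)"
    unfolding bij_betw_def
  proof
    show "inj_on (\<lambda>\<tau>. \<sigma>\<^sub>1 \<cdot> (\<tau> \<star> id2 M i\<^sub>1)) (hom2 M k h)"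
    proof (rule inj_onI)
      fix \<tau> \<tau>'
      assume \<tau>: "\<tau> \<in> hom2 M k h" and \<tau>': "\<tau>' \<in> hom2 M k h"
        and eq: "\<sigma>\<^sub>1 \<cdot> (\<tau> \<star> id2 M i\<^sub>1) = \<sigma>\<^sub>1 \<cdot> (\<tau>' \<star> id2 M i\<^sub>1)"
      obtain \<theta> where \<theta>: "\<theta> \<in> hom2 M (k \<odot> i\<^sub>0) r" "\<sigma>\<^sub>0 \<cdot> \<theta> = \<tau> \<star> id2 M i\<^sub>0"
        "\<rho> \<cdot> (\<theta> \<star> id2 M j) = (\<sigma>\<^sub>1 \<cdot> (\<tau> \<star> id2 M i\<^sub>1)) \<cdot> W k"
        by (rule induced_cell_restrict[OF k \<tau>])
      obtain \<theta>' where \<theta>': "\<theta>' \<in> hom2 M (k \<odot> i\<^sub>0) r" "\<sigma>\<^sub>0 \<cdot> \<theta>' = \<tau>' \<star> id2 M i\<^sub>0"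
        "\<rho> \<cdot> (\<theta>' \<star> id2 M j) = (\<sigma>\<^sub>1 \<cdot> (\<tau>' \<star> id2 M i\<^sub>1)) \<cdot> W k"
        by (rule induced_cell_restrict[OF k \<tau>'])
      \<comment> \<open>Equal composites with \<open>\<sigma>\<^sub>1\<close> give equal right-hand
        sides in the two squares, and \<rho> detects equality of \<theta> and \<theta>'.\<close>
      have "\<theta> = \<theta>'"
        using inj_onD[OF bij_betw_imp_inj_on[OF bij]] \<theta> \<theta>' eq by metis
      moreover have "\<sigma>\<^sub>1 \<cdot> (\<tau> \<star> id2 M i\<^sub>1) \<in> hom2 M (k \<odot> i\<^sub>1) f"
        using vcomp_hom whisker_hom[OF i1 k \<tau>] sigma1(1) by blast
      ultimately show "\<tau> = \<tau>'"
        using induced_cell[OF k \<theta>(1) _ \<theta>(3)] \<theta>(2) \<theta>'(2) \<tau> \<tau>' eq by metis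
    qed
    show "(\<lambda>\<tau>. \<sigma>\<^sub>1 \<cdot> (\<tau> \<star> id2 M i\<^sub>1)) ` hom2 M k h = hom2 M (k \<odot> i\<^sub>1) f"
    proof
      show "(\<lambda>\<tau>. \<sigma>\<^sub>1 \<cdot> (\<tau> \<star> id2 M i\<^sub>1)) ` hom2 M k h \<subseteq> hom2 M (k \<odot> i\<^sub>1) f"
        using vcomp_hom whisker_hom[OF i1 k] sigma1(1) by blast
      show "hom2 M (k \<odot> i\<^sub>1) f \<subseteq> (\<lambda>\<tau>. \<sigma>\<^sub>1 \<cdot> (\<tau> \<star> id2 M i\<^sub>1)) ` hom2 M k h"
      proof
        fix \<phi> assume \<phi>: "\<phi> \<in> hom2 M (k \<odot> i\<^sub>1) f"
        have "\<phi> \<cdot> W k \<in> hom2 M ((k \<odot> i\<^sub>0) \<odot> j) f"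
          using vcomp_hom[OF W_hom[OF k] \<phi>] .
        then obtain \<theta> where "\<theta> \<in> hom2 M (k \<odot> i\<^sub>0) r" "\<rho> \<cdot> (\<theta> \<star> id2 M j) = \<phi> \<cdot> W k"
          using bij_betw_imp_surj_on[OF bij] by (metis (no_types, lifting) imageE)
        then show "\<phi> \<in> (\<lambda>\<tau>. \<sigma>\<^sub>1 \<cdot> (\<tau> \<star> id2 M i\<^sub>1)) ` hom2 M k h"
          using induced_cell[OF k _ \<phi>] by blast
      qed
    qed
  qed
qed

text \<open>Essential surjectivity at the cocone (g, 1, g j). As its 2-morphism is an identity, the
  compatibility square of the isomorphism (\<alpha>, \<beta>) expresses
  \<open>\<alpha> \<star> id2 M j\<close> through \<beta>. Of the inverse only \<alpha>' with
  \<alpha> \<alpha>' = 1 is kept.\<close>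

lemma collage_presentation:
  assumes g: "g \<in> hom1 M B X"
  obtains k \<alpha> \<alpha>' \<beta> where "k \<in> hom1 M Cj X"
    "\<alpha> \<in> hom2 M (k \<odot> i\<^sub>0) g" "\<alpha>' \<in> hom2 M g (k \<odot> i\<^sub>0)" "\<alpha> \<cdot> \<alpha>' = id2 M g"
    "\<beta> \<in> hom2 M (k \<odot> i\<^sub>1) (g \<odot> j)" "\<alpha> \<star> id2 M j = \<beta> \<cdot> W k"
proof -
  have gj: "g \<odot> j \<in> hom1 M A X" using comp1_hom[OF j g] .
  then have id: "id2 M (g \<odot> j) \<in> hom2 M (g \<odot> j) (g \<odot> j)"
    using id2_hom unfolding hom1_def by blast
  have "(g, id2 M (g \<odot> j), g \<odot> j) \<in> Obj (cocone_cat j X)"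
    unfolding cocone_cat_Obj[OF j] using g gj id by blast
  then obtain k e where k: "k \<in> hom1 M Cj X"
    and e: "e \<in> arrows (cocone_cat j X) (k \<odot> i\<^sub>0, W k, k \<odot> i\<^sub>1) (g, id2 M (g \<odot> j), g \<odot> j)"
      "iso_arrow (cocone_cat j X) e"
    by (rule is_equivalence_essentially_surjective[OF equivalence])
      (simp only: collage_func_fobj hom_cat_simps)
  obtain \<alpha> \<beta> where e_eq: "e = ((k \<odot> i\<^sub>0, W k, k \<odot> i\<^sub>1), (\<alpha>, \<beta>), (g, id2 M (g \<odot> j), g \<odot> j))"
    and \<alpha>: "\<alpha> \<in> hom2 M (k \<odot> i\<^sub>0) g" and \<beta>: "\<beta> \<in> hom2 M (k \<odot> i\<^sub>1) (g \<odot> j)"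
    and eq: "id2 M (g \<odot> j) \<cdot> (\<alpha> \<star> id2 M j) = \<beta> \<cdot> W k"
    using e(1) unfolding cocone_cat_arrow[OF j] by blast
  have src_trg: "src M j = A" "trg M j = B" using j unfolding hom1_def by auto
  obtain \<alpha>' where "\<alpha>' \<in> arrows (hom_cat M B X) g (k \<odot> i\<^sub>0)" "\<alpha> \<cdot> \<alpha>' = id2 M g"
    using e(2) unfolding e_eq cocone_cat_def src_trg
    by (rule comma_iso_arrowE) simp
  moreover have "\<alpha> \<star> id2 M j = \<beta> \<cdot> W k"
    using eq id2_left[OF whisker_hom[OF j _ \<alpha>]] comp1_hom[OF i0 k] by simp
  ultimately show ?thesis
    using that k \<alpha> \<beta> arrows_hom_cat(1)[OF g] by simp
qed

text \<open>The bijection at the k presenting g is carried over to g: precomposition with \<alpha>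
  and \<beta> passes from g to k, and \<alpha>' leads back.\<close>

lemma right_extension_j:
  assumes "right_extension i\<^sub>1 f h \<sigma>\<^sub>1"
  shows "right_extension j f r \<rho>"
  unfolding right_extension_j_iff
proof
  fix g assume g: "g \<in> hom1 M B X"
  obtain k \<alpha> \<alpha>' \<beta> where k: "k \<in> hom1 M Cj X"
    and \<alpha>: "\<alpha> \<in> hom2 M (k \<odot> i\<^sub>0) g" "\<alpha>' \<in> hom2 M g (k \<odot> i\<^sub>0)" "\<alpha> \<cdot> \<alpha>' = id2 M g"
    and \<beta>: "\<beta> \<in> hom2 M (k \<odot> i\<^sub>1) (g \<odot> j)"
    and \<alpha>j: "\<alpha> \<star> id2 M j = \<beta> \<cdot> W k"
    by (rule collage_presentation[OF g])
  have ki0: "k \<odot> i\<^sub>0 \<in> hom1 M B X" using comp1_hom[OF i0 k] .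
  have bij: "bij_betw (\<lambda>\<tau>. \<sigma>\<^sub>1 \<cdot> (\<tau> \<star> id2 M i\<^sub>1)) (hom2 M k h) (hom2 M (k \<odot> i\<^sub>1) f)"
    using assms k unfolding right_extension_i1_iff by blast
  have \<rho>\<theta>: "\<rho> \<cdot> (\<theta> \<star> id2 M j) \<in> hom2 M (g \<odot> j) f" if "\<theta> \<in> hom2 M g r" for \<theta>
    using vcomp_hom[OF whisker_hom[OF j g that] rho] .
  \<comment> \<open>Here \<tau> encodes the pair of \<theta> \<alpha> and \<rho> (\<theta> j)
    \<beta>, which is compatible because \<open>\<alpha>j\<close> replaces \<alpha> j by \<beta>
    after \<open>W k\<close>.\<close>
  have pair: "\<exists>\<tau> \<in> hom2 M k h. \<tau> \<star> id2 M i\<^sub>0 = \<sigma>\<^sub>0 \<cdot> \<theta> \<cdot> \<alpha> \<and>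
      \<sigma>\<^sub>1 \<cdot> (\<tau> \<star> id2 M i\<^sub>1) = (\<rho> \<cdot> (\<theta> \<star> id2 M j)) \<cdot> \<beta>" if \<theta>: "\<theta> \<in> hom2 M g r" for \<theta>
  proof -
    have \<theta>j: "\<theta> \<star> id2 M j \<in> hom2 M (g \<odot> j) (r \<odot> j)" using whisker_hom[OF j g \<theta>] .
    have "\<rho> \<cdot> ((\<theta> \<cdot> \<alpha>) \<star> id2 M j) = (\<rho> \<cdot> (\<theta> \<star> id2 M j)) \<cdot> \<beta> \<cdot> W k"
      using whisker_vcomp[OF j ki0 \<alpha>(1) \<theta>] vcomp_assoc[OF whisker_hom[OF j ki0 \<alpha>(1)] \<theta>j rho]
      by (simp add: \<alpha>j)
    also have "\<dots> = ((\<rho> \<cdot> (\<theta> \<star> id2 M j)) \<cdot> \<beta>) \<cdot> W k"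
      using vcomp_assoc[OF W_hom[OF k] \<beta> \<rho>\<theta>[OF \<theta>]] by simp
    finally show ?thesis
      using induced_cell[OF k vcomp_hom[OF \<alpha>(1) \<theta>] vcomp_hom[OF \<beta> \<rho>\<theta>[OF \<theta>]]] by blast
  qed
  show "bij_betw (\<lambda>\<theta>. \<rho> \<cdot> (\<theta> \<star> id2 M j)) (hom2 M g r) (hom2 M (g \<odot> j) f)"
    unfolding bij_betw_def
  proof
    show "inj_on (\<lambda>\<theta>. \<rho> \<cdot> (\<theta> \<star> id2 M j)) (hom2 M g r)"
    proof (rule inj_onI)
      fix \<theta> \<theta>'
      assume \<theta>: "\<theta> \<in> hom2 M g r" and \<theta>': "\<theta>' \<in> hom2 M g r"
        and eq: "\<rho> \<cdot> (\<theta> \<star> id2 M j) = \<rho> \<cdot> (\<theta>' \<star> id2 M j)"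
      obtain \<sigma>' where \<sigma>': "\<sigma>' \<in> hom2 M (h \<odot> i\<^sub>0) r" "\<sigma>' \<cdot> \<sigma>\<^sub>0 = id2 M r"
        using invertible2E[OF sigma0(2,1)] by metis
      obtain \<tau> where \<tau>: "\<tau> \<in> hom2 M k h" "\<tau> \<star> id2 M i\<^sub>0 = \<sigma>\<^sub>0 \<cdot> \<theta> \<cdot> \<alpha>"
        "\<sigma>\<^sub>1 \<cdot> (\<tau> \<star> id2 M i\<^sub>1) = (\<rho> \<cdot> (\<theta> \<star> id2 M j)) \<cdot> \<beta>"
        using pair[OF \<theta>] by blast
      obtain \<tau>' where \<tau>': "\<tau>' \<in> hom2 M k h" "\<tau>' \<star> id2 M i\<^sub>0 = \<sigma>\<^sub>0 \<cdot> \<theta>' \<cdot> \<alpha>"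
        "\<sigma>\<^sub>1 \<cdot> (\<tau>' \<star> id2 M i\<^sub>1) = (\<rho> \<cdot> (\<theta>' \<star> id2 M j)) \<cdot> \<beta>"
        using pair[OF \<theta>'] by blast
      have "\<tau> = \<tau>'"
        using inj_onD[OF bij_betw_imp_inj_on[OF bij]] \<tau> \<tau>' eq by metis
      \<comment> \<open>Compare the restrictions of \<tau> and \<tau>' along
        \<open>i\<^sub>0\<close> and cancel \<open>\<sigma>\<^sub>0\<close>; afterwards \<alpha>
        cancels by its right inverse.\<close>
      then have "\<theta> \<cdot> \<alpha> = \<theta>' \<cdot> \<alpha>"
        using \<tau>(2) \<tau>'(2) vcomp_cancel_left[OF vcomp_hom[OF \<alpha>(1) \<theta>] sigma0(1) \<sigma>']
          vcomp_cancel_left[OF vcomp_hom[OF \<alpha>(1) \<theta>'] sigma0(1) \<sigma>'] by metis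
      then show "\<theta> = \<theta>'"
        using vcomp_cancel_right[OF \<theta> \<alpha>] vcomp_cancel_right[OF \<theta>' \<alpha>] by metis
    qed
    show "(\<lambda>\<theta>. \<rho> \<cdot> (\<theta> \<star> id2 M j)) ` hom2 M g r = hom2 M (g \<odot> j) f"
    proof
      show "(\<lambda>\<theta>. \<rho> \<cdot> (\<theta> \<star> id2 M j)) ` hom2 M g r \<subseteq> hom2 M (g \<odot> j) f"
        using \<rho>\<theta> by blast
      show "hom2 M (g \<odot> j) f \<subseteq> (\<lambda>\<theta>. \<rho> \<cdot> (\<theta> \<star> id2 M j)) ` hom2 M g r"
      proof
        fix \<phi> assume \<phi>: "\<phi> \<in> hom2 M (g \<odot> j) f"
        \<comment> \<open>Surjectivity at k applies to \<phi> \<beta>. The resulting \<tau>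
          restricts to \<theta> on \<open>k \<odot> i\<^sub>0\<close>, and \<theta> \<alpha>' is the
          preimage of \<phi>.\<close>
        obtain \<tau> where \<tau>: "\<tau> \<in> hom2 M k h" "\<phi> \<cdot> \<beta> = \<sigma>\<^sub>1 \<cdot> (\<tau> \<star> id2 M i\<^sub>1)"
          using bij_betw_imp_surj_on[OF bij] vcomp_hom[OF \<beta> \<phi>] by blast
        obtain \<theta> where \<theta>: "\<theta> \<in> hom2 M (k \<odot> i\<^sub>0) r" "\<rho> \<cdot> (\<theta> \<star> id2 M j) = (\<phi> \<cdot> \<beta>) \<cdot> W k"
          by (rule induced_cell_restrict[OF k \<tau>(1)]) (use \<tau>(2) in auto)
        have \<alpha>j_hom: "\<alpha> \<star> id2 M j \<in> hom2 M ((k \<odot> i\<^sub>0) \<odot> j) (g \<odot> j)"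
          and \<alpha>'j_hom: "\<alpha>' \<star> id2 M j \<in> hom2 M (g \<odot> j) ((k \<odot> i\<^sub>0) \<odot> j)"
          using whisker_hom[OF j ki0 \<alpha>(1)] whisker_hom[OF j g \<alpha>(2)] by blast+
        have "\<rho> \<cdot> ((\<theta> \<cdot> \<alpha>') \<star> id2 M j) = (\<rho> \<cdot> (\<theta> \<star> id2 M j)) \<cdot> (\<alpha>' \<star> id2 M j)"
          using whisker_vcomp[OF j g \<alpha>(2) \<theta>(1)]
            vcomp_assoc[OF \<alpha>'j_hom whisker_hom[OF j ki0 \<theta>(1)] rho] by simp
        also have "\<rho> \<cdot> (\<theta> \<star> id2 M j) = \<phi> \<cdot> (\<alpha> \<star> id2 M j)"
          using \<theta>(2) vcomp_assoc[OF W_hom[OF k] \<beta> \<phi>] \<alpha>j by simp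
        also have "(\<phi> \<cdot> (\<alpha> \<star> id2 M j)) \<cdot> (\<alpha>' \<star> id2 M j) = \<phi>"
          using vcomp_cancel_right[OF \<phi> \<alpha>j_hom \<alpha>'j_hom] whisker_vcomp[OF j g \<alpha>(2,1)]
            \<alpha>(3) hcomp_id2[OF j g] by simp
        finally show "\<phi> \<in> (\<lambda>\<theta>. \<rho> \<cdot> (\<theta> \<star> id2 M j)) ` hom2 M g r"
          using vcomp_hom[OF \<alpha>(2) \<theta>(1)] by force
      qed
    qed
  qed
qed

text \<open>Condition (2) of compatibility speaks of \<open>h \<odot> i\<^sub>0\<close> and
  \<open>h \<odot> i\<^sub>1\<close> themselves, which are only isomorphic to r and f;
  \<open>iso_closed\<close> bridges this.\<close>

lemma induced_mem:
  assumes "iso_closed K" "compatible K j Cj i\<^sub>0 i\<^sub>1 \<nu>" "f \<in> K" "r \<in> K"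
  shows "h \<in> K"
proof -
  obtain \<sigma>' where \<sigma>': "\<sigma>' \<in> hom2 M f (h \<odot> i\<^sub>1)"
    "\<sigma>' \<cdot> \<sigma>\<^sub>1 = id2 M (h \<odot> i\<^sub>1)" "\<sigma>\<^sub>1 \<cdot> \<sigma>' = id2 M f"
    using invertible2E[OF sigma1(2,1)] by metis
  \<comment> \<open>\<open>iso_closed\<close> moves along 2-morphisms out of a member of
    \<open>K\<close>, whereas \<open>\<sigma>\<^sub>1\<close> ends at f; hence its inverse is
    used.\<close>
  have "invertible2 M \<sigma>'"
    using \<sigma>' sigma1(1) unfolding invertible2_def inverse2_def hom2_def by auto
  then have "h \<odot> i\<^sub>1 \<in> K" using assms(1,3) \<sigma>'(1) unfolding iso_closed_def by blast
  moreover have "h \<odot> i\<^sub>0 \<in> K" using assms(1,4) sigma0 unfolding iso_closed_def by blast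
  ultimately show ?thesis using assms(2) h X_Ob unfolding compatible_def by blast
qed

end

text \<open>Once right extensions are transferred, membership in \<open>K\<close> remains. In (i) it
  is assumed for j, f and r; in (ii) compatibility gives it for \<open>i\<^sub>1\<close>, and
  \<open>induced_mem\<close>, through \<open>iso_closed\<close>, for h.\<close>

theorem corollary5:
  fixes M :: "('o, 'm, 't) bicat" and K :: "'m set"
    and A B X Cj :: 'o and j f r i\<^sub>0 i\<^sub>1 h :: 'm and \<rho> \<nu> \<sigma>\<^sub>0 \<sigma>\<^sub>1 :: 't
  assumes "bicategory M"
    and "bicategory.map_class M K"
    and "j \<in> K" and "f \<in> K" and "r \<in> K"
    and "j \<in> hom1 M A B" and "f \<in> hom1 M A X" and "r \<in> hom1 M B X"
    and "\<rho> \<in> hom2 M (r \<odot>\<^bsub>M\<^esub> j) f"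
    and "bicategory.collage M j Cj i\<^sub>0 i\<^sub>1 \<nu>"
    and "bicategory.induced M j Cj i\<^sub>0 i\<^sub>1 \<nu> f r \<rho> h \<sigma>\<^sub>0 \<sigma>\<^sub>1"
  shows "(bicategory.pointwise_right_extension M K i\<^sub>1 f h \<sigma>\<^sub>1 \<longrightarrow>
            bicategory.pointwise_right_extension M K j f r \<rho>) \<and>
         (bicategory.iso_closed M K \<longrightarrow>
          bicategory.compatible M K j Cj i\<^sub>0 i\<^sub>1 \<nu> \<longrightarrow>
          bicategory.pointwise_right_extension M K j f r \<rho> \<longrightarrow>
            bicategory.pointwise_right_extension M K i\<^sub>1 f h \<sigma>\<^sub>1)"
proof -
  interpret bicategory M by fact
  interpret collage_cocone M A B X Cj j f r i\<^sub>0 i\<^sub>1 h \<rho> \<nu> \<sigma>\<^sub>0 \<sigma>\<^sub>1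
    by unfold_locales (use assms in auto)
  show ?thesis
    using right_extension_j right_extension_i1 induced_mem[of K] \<open>j \<in> K\<close> \<open>f \<in> K\<close> \<open>r \<in> K\<close>
    unfolding pointwise_right_extension_def compatible_def by blast
qed

end
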